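(* Let $\mathcal{C}\subseteq F^n$ be a generalized skew differential Goppa code with Goppa polynomial $g\in R=L[x;\sigma,\partial]$ and positional points $\alpha_0,\dots,\alpha_{n-1}$, where $\{\alpha_0,\dots,\alpha_{n-1}\}$ is left P-independent. Let $e=\sum_{j=1}^{\nu}e_j\varepsilon_{k_j}\in F^n$ be an error vector with $k_1,\dots,k_\nu\in\{0,\dots,n-1\}$ distinct, all $e_j\ne0$ and $\nu\le t=\lfloor \deg g/2\rfloor$, and let $\lambda=[\{x-\alpha_{k_j}:1\le j\le\nu\}]_\ell$ be the error locator polynomial. Then, for $k\in\{0,\dots,n-1\}$, $$(x-\alpha_k)\mid_r\lambda\quad\text{if and only if}\quad k\in\{k_1,\dots,k_\nu\}.$$
   Context: $L$ is a field, $\sigma$ an automorphism of $L$ of finite order, $\partial:L\to L$ a $\sigma$-derivation (additive, with $\partial(ab)=\sigma(a)\partial(b)+\partial(a)b$), and $R=L[x;\sigma,\partial]$ is the Ore polynomial ring: polynomials $\sum_i a_ix^i$, $a_i\in L$, with $xa=\sigma(a)x+\partial(a)$. $R$ is a left and right Euclidean domain. $f\mid_r g$ means $g=uf$ for some $u\in R$. $[f_1,\dots,f_m]_\ell$ (least common left multiple) is a generator of $Rf_1\cap\dots\cap Rf_m$ (unique up to left multiplication by $L^*$; equal to $1$ for the empty family); $(f_1,f_2)_r$ is a generator of $Rf_1+Rf_2$. Skew differential Goppa code: $F\subseteq L$ is a field extension, $0\ne g\in R$ is invariant ($Rg=gR$), $\alpha_0,\dots,\alpha_{n-1}\in L$ are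 different elements with $(x-\alpha_i,g)_r=1$, $\eta_0,\dots,\eta_{n-1}\in L^*$, the $h_i\in R$ are determined by $\deg h_i<\deg g$ and $(x-\alpha_i)h_i-1\in Rg$, and $\mathcal{C}=\{(c_0,\dots,c_{n-1})\in F^n:\sum_i h_i\eta_ic_i=0\}$. $\{\alpha_0,\dots,\alpha_{n-1}\}$ is left P-independent if $\deg[\{x-\alpha_i:0\le i\le n-1\}]_\ell=n$. $\{\varepsilon_0,\dots,\varepsilon_{n-1}\}$ is the canonical basis of $F^n$. *)

theory Defs
  imports "HOL-Computational_Algebra.Polynomial"
begin

definition field_automorphism :: "('a::field \<Rightarrow> 'a) \<Rightarrow> bool" where
  "field_automorphism \<sigma> \<longleftrightarrow>
     bij \<sigma> \<and> \<sigma> 1 = 1 \<and> (\<forall>a b. \<sigma> (a + b) = \<sigma> a + \<sigma> b) \<and> (\<forall>a b. \<sigma> (a * b) = \<sigma> a * \<sigma> b)"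

definition finite_order :: "('a \<Rightarrow> 'a) \<Rightarrow> bool" where
  "finite_order \<sigma> \<longleftrightarrow> (\<exists>m>0. \<sigma> ^^ m = id)"

definition skew_derivation :: "('a::field \<Rightarrow> 'a) \<Rightarrow> ('a \<Rightarrow> 'a) \<Rightarrow> bool" where
  "skew_derivation \<sigma> \<delta> \<longleftrightarrow>
     (\<forall>a b. \<delta> (a + b) = \<delta> a + \<delta> b) \<and> (\<forall>a b. \<delta> (a * b) = \<sigma> a * \<delta> b + \<delta> a * b)"

definition subfield_set :: "'a::field set \<Rightarrow> bool" where
  "subfield_set F \<longleftrightarrow>
     0 \<in> F \<and> 1 \<in> F \<and> (\<forall>a\<in>F. \<forall>b\<in>F. a + b \<in> F \<and> a * b \<in> F) \<and> (\<forall>a\<in>F. - a \<in> F \<and> inverse a \<in> F)"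

text \<open>
  The elements of the Ore polynomial ring \<open>R = L[x;\<sigma>,\<delta>]\<close> are represented by the type
  \<^typ>\<open>'a poly\<close>, with coefficients written on the left: \<^term>\<open>p :: 'a poly\<close> stands for the sum of
  all \<open>a\<^sub>i x\<^sup>i\<close> with \<open>a\<^sub>i = coeff p i\<close>. Addition, degree, and left multiplication by scalars
  (\<^const>\<open>smult\<close>) are those of \<^typ>\<open>'a poly\<close>; the product of \<open>R\<close> is \<open>ore_mult\<close>, not the
  commutative product \<open>*\<close> of the type.
\<close>

text \<open>Left multiplication by \<open>x\<close>: the term \<open>a x\<^sup>i\<close> becomes \<open>\<sigma>(a) x\<^sup>i\<^sup>+\<^sup>1 + \<delta>(a) x\<^sup>i\<close>.\<close>

definition ore_x_mult :: "('a::field \<Rightarrow> 'a) \<Rightarrow> ('a \<Rightarrow> 'a) \<Rightarrow> 'a poly \<Rightarrow> 'a poly" where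
  "ore_x_mult \<sigma> \<delta> p = pCons 0 (map_poly \<sigma> p) + map_poly \<delta> p"

definition ore_mult :: "('a::field \<Rightarrow> 'a) \<Rightarrow> ('a \<Rightarrow> 'a) \<Rightarrow> 'a poly \<Rightarrow> 'a poly \<Rightarrow> 'a poly" where
  "ore_mult \<sigma> \<delta> p q = (\<Sum>i\<le>degree p. smult (coeff p i) ((ore_x_mult \<sigma> \<delta> ^^ i) q))"

definition left_ideal :: "('a::field \<Rightarrow> 'a) \<Rightarrow> ('a \<Rightarrow> 'a) \<Rightarrow> 'a poly \<Rightarrow> 'a poly set" where
  "left_ideal \<sigma> \<delta> f = {ore_mult \<sigma> \<delta> u f |u. True}"

definition right_ideal :: "('a::field \<Rightarrow> 'a) \<Rightarrow> ('a \<Rightarrow> 'a) \<Rightarrow> 'a poly \<Rightarrow> 'a poly set" where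
  "right_ideal \<sigma> \<delta> f = {ore_mult \<sigma> \<delta> f u |u. True}"

definition right_dvd :: "('a::field \<Rightarrow> 'a) \<Rightarrow> ('a \<Rightarrow> 'a) \<Rightarrow> 'a poly \<Rightarrow> 'a poly \<Rightarrow> bool" where
  "right_dvd \<sigma> \<delta> f g \<longleftrightarrow> (\<exists>u. g = ore_mult \<sigma> \<delta> u f)"

definition ore_invariant :: "('a::field \<Rightarrow> 'a) \<Rightarrow> ('a \<Rightarrow> 'a) \<Rightarrow> 'a poly \<Rightarrow> bool" where
  "ore_invariant \<sigma> \<delta> g \<longleftrightarrow> left_ideal \<sigma> \<delta> g = right_ideal \<sigma> \<delta> g"

text \<open>
  Greatest common right divisors and least common left multiples are determined only up to left
  multiplication by nonzero scalars, so they are relations. For \<open>S = {}\<close> the intersection is all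
  of \<open>R\<close>, and the least common left multiples are the nonzero constants.
\<close>

definition is_gcrd ::
  "('a::field \<Rightarrow> 'a) \<Rightarrow> ('a \<Rightarrow> 'a) \<Rightarrow> 'a poly \<Rightarrow> 'a poly \<Rightarrow> 'a poly \<Rightarrow> bool" where
  "is_gcrd \<sigma> \<delta> f1 f2 d \<longleftrightarrow>
     left_ideal \<sigma> \<delta> d = {u + v |u v. u \<in> left_ideal \<sigma> \<delta> f1 \<and> v \<in> left_ideal \<sigma> \<delta> f2}"

definition is_lclm :: "('a::field \<Rightarrow> 'a) \<Rightarrow> ('a \<Rightarrow> 'a) \<Rightarrow> 'a poly set \<Rightarrow> 'a poly \<Rightarrow> bool" where
  "is_lclm \<sigma> \<delta> S l \<longleftrightarrow> left_ideal \<sigma> \<delta> l = (\<Inter>f\<in>S. left_ideal \<sigma> \<delta> f)"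

abbreviation x_minus :: "'a::field \<Rightarrow> 'a poly" where
  "x_minus a \<equiv> [:- a, 1:]"

definition left_P_independent :: "('a::field \<Rightarrow> 'a) \<Rightarrow> ('a \<Rightarrow> 'a) \<Rightarrow> 'a set \<Rightarrow> bool" where
  "left_P_independent \<sigma> \<delta> A \<longleftrightarrow>
     finite A \<and> (\<exists>l. is_lclm \<sigma> \<delta> (x_minus ` A) l \<and> degree l = card A)"

text \<open>The space \<open>F\<^sup>n\<close>: vectors are functions on the indices \<open>0, \<dots>, n - 1\<close>, extended by zero.\<close>

definition vecs :: "'a::field set \<Rightarrow> nat \<Rightarrow> (nat \<Rightarrow> 'a) set" where
  "vecs F n = {c. (\<forall>i<n. c i \<in> F) \<and> (\<forall>i\<ge>n. c i = 0)}"

definition canonical_vec :: "nat \<Rightarrow> nat \<Rightarrow> 'a::field" where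
  "canonical_vec i = (\<lambda>j. if j = i then 1 else 0)"

text \<open>
  The disjunct \<open>h i = 0\<close> is needed because \<^const>\<open>degree\<close> sends the zero polynomial to 0 rather
  than to minus infinity: for constant \<open>g\<close> the polynomials \<open>h i\<close> are zero.
  In the defining equation of the code the scalars stand to the right of \<open>h i\<close>.
\<close>

definition skew_differential_goppa_code ::
  "('a::field \<Rightarrow> 'a) \<Rightarrow> ('a \<Rightarrow> 'a) \<Rightarrow> 'a set \<Rightarrow> nat \<Rightarrow> 'a poly \<Rightarrow> (nat \<Rightarrow> 'a) \<Rightarrow> (nat \<Rightarrow> 'a)
    \<Rightarrow> (nat \<Rightarrow> 'a) set \<Rightarrow> bool" where
  "skew_differential_goppa_code \<sigma> \<delta> F n g \<alpha> \<eta> C \<longleftrightarrow>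
     subfield_set F \<and>
     g \<noteq> 0 \<and> ore_invariant \<sigma> \<delta> g \<and>
     inj_on \<alpha> {..<n} \<and> (\<forall>i<n. is_gcrd \<sigma> \<delta> (x_minus (\<alpha> i)) g 1) \<and>
     (\<forall>i<n. \<eta> i \<noteq> 0) \<and>
     (\<exists>h. (\<forall>i<n. (h i = 0 \<or> degree (h i) < degree g) \<and>
                   ore_mult \<sigma> \<delta> (x_minus (\<alpha> i)) (h i) - 1 \<in> left_ideal \<sigma> \<delta> g) \<and>
          C = {c \<in> vecs F n. (\<Sum>i<n. ore_mult \<sigma> \<delta> (h i) [:\<eta> i * c i:]) = 0})"

subsection \<open>Adequacy of the product\<close>

lemma ore_mult_eq_sum:
  assumes "degree p \<le> N"
  shows "ore_mult \<sigma> \<delta> p q = (\<Sum>i\<le>N. smult (coeff p i) ((ore_x_mult \<sigma> \<delta> ^^ i) q))"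
  unfolding ore_mult_def using assms
  by (intro sum.mono_neutral_left) (auto simp: not_le coeff_eq_0)

lemma ore_mult_add_left: "ore_mult \<sigma> \<delta> (p + q) r = ore_mult \<sigma> \<delta> p r + ore_mult \<sigma> \<delta> q r"
proof -
  define N where "N = max (degree p) (degree q)"
  have "degree p \<le> N" "degree q \<le> N" "degree (p + q) \<le> N"
    by (auto simp: N_def intro: degree_add_le)
  then show ?thesis
    by (simp add: ore_mult_eq_sum smult_add_left sum.distrib)
qed

lemma ore_mult_smult_left: "ore_mult \<sigma> \<delta> (smult a p) r = smult a (ore_mult \<sigma> \<delta> p r)"
proof -
  have "smult a (sum f A) = (\<Sum>i\<in>A. smult a (f i))" for f :: "nat \<Rightarrow> 'a poly" and A
    by (induction A rule: infinite_finite_induct) (auto simp: smult_add_right)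
  then show ?thesis
    using ore_mult_eq_sum[of "smult a p" "degree p" \<sigma> \<delta> r]
    by (simp add: ore_mult_def degree_smult_le)
qed

lemma ore_mult_0_left [simp]: "ore_mult \<sigma> \<delta> 0 q = 0"
  by (simp add: ore_mult_def)

lemma ore_mult_const_left: "ore_mult \<sigma> \<delta> [:a:] q = smult a q"
  by (simp add: ore_mult_def)

lemma ore_mult_1_left: "ore_mult \<sigma> \<delta> 1 q = q"
  by (simp add: ore_mult_def)

lemma ore_mult_x_left: "ore_mult \<sigma> \<delta> [:0, 1:] q = ore_x_mult \<sigma> \<delta> q"
  by (simp add: ore_mult_def)

context
  fixes \<sigma> \<delta> :: "'a::field \<Rightarrow> 'a"
  assumes aut: "field_automorphism \<sigma>" and der: "skew_derivation \<sigma> \<delta>"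
begin

lemma automorphism_0: "\<sigma> 0 = 0"
  using aut unfolding field_automorphism_def by (metis add_cancel_right_right)

lemma derivation_0: "\<delta> 0 = 0"
  using der unfolding skew_derivation_def by (metis add_cancel_right_right)

lemma derivation_1: "\<delta> 1 = 0"
  using aut der unfolding skew_derivation_def field_automorphism_def
  by (metis add_cancel_right_right mult.left_neutral mult.right_neutral)

lemma coeff_ore_x_mult:
  "coeff (ore_x_mult \<sigma> \<delta> p) i = (if i = 0 then 0 else \<sigma> (coeff p (i - 1))) + \<delta> (coeff p i)"
  by (auto simp: ore_x_mult_def coeff_map_poly automorphism_0 derivation_0 coeff_pCons
           split: nat.splits)

lemma ore_x_mult_add: "ore_x_mult \<sigma> \<delta> (p + q) = ore_x_mult \<sigma> \<delta> p + ore_x_mult \<sigma> \<delta> q"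
  using aut der
  by (intro poly_eqI) (auto simp: coeff_ore_x_mult field_automorphism_def skew_derivation_def)

lemma ore_x_mult_smult:
  "ore_x_mult \<sigma> \<delta> (smult a p) = smult (\<sigma> a) (ore_x_mult \<sigma> \<delta> p) + smult (\<delta> a) p"
  using aut der
  by (intro poly_eqI)
     (auto simp: coeff_ore_x_mult field_automorphism_def skew_derivation_def algebra_simps)

lemma ore_x_mult_0: "ore_x_mult \<sigma> \<delta> 0 = 0"
  by (simp add: ore_x_mult_def)

lemma ore_mult_x_const: "ore_mult \<sigma> \<delta> [:0, 1:] [:a:] = [:\<delta> a, \<sigma> a:]"
  by (rule poly_eqI)
     (auto simp: ore_mult_x_left coeff_ore_x_mult coeff_pCons automorphism_0 derivation_0
           split: nat.splits)

lemma ore_x_mult_monom_1: "ore_x_mult \<sigma> \<delta> (monom 1 i) = monom 1 (Suc i)"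
  using aut
  by (intro poly_eqI)
     (auto simp: coeff_ore_x_mult automorphism_0 derivation_0 derivation_1 field_automorphism_def)

lemma ore_mult_add_right: "ore_mult \<sigma> \<delta> p (q + r) = ore_mult \<sigma> \<delta> p q + ore_mult \<sigma> \<delta> p r"
proof -
  have "(ore_x_mult \<sigma> \<delta> ^^ i) (q + r) = (ore_x_mult \<sigma> \<delta> ^^ i) q + (ore_x_mult \<sigma> \<delta> ^^ i) r" for i
    by (induction i) (auto simp: ore_x_mult_add)
  then show ?thesis
    by (simp add: ore_mult_def smult_add_right sum.distrib)
qed

lemma ore_mult_1_right: "ore_mult \<sigma> \<delta> p 1 = p"
proof -
  have "(ore_x_mult \<sigma> \<delta> ^^ i) 1 = monom 1 i" for i
    by (induction i) (auto simp: ore_x_mult_monom_1)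
  then show ?thesis
    by (simp add: ore_mult_def smult_monom poly_as_sum_of_monoms)
qed

lemma ore_mult_pCons_left:
  "ore_mult \<sigma> \<delta> (pCons a p) q = smult a q + ore_mult \<sigma> \<delta> p (ore_x_mult \<sigma> \<delta> q)"
proof -
  have "ore_mult \<sigma> \<delta> (pCons a p) q =
      (\<Sum>i\<le>Suc (degree p). smult (coeff (pCons a p) i) ((ore_x_mult \<sigma> \<delta> ^^ i) q))"
    by (rule ore_mult_eq_sum) (simp add: degree_pCons_le)
  also have "\<dots> = smult a q + ore_mult \<sigma> \<delta> p (ore_x_mult \<sigma> \<delta> q)"
    unfolding sum.atMost_Suc_shift by (simp add: ore_mult_def funpow_swap1)
  finally show ?thesis .
qed

lemma ore_x_mult_ore_mult: "ore_x_mult \<sigma> \<delta> (ore_mult \<sigma> \<delta> p q) = ore_mult \<sigma> \<delta> (ore_x_mult \<sigma> \<delta> p) q"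
proof (induction p arbitrary: q)
  case 0
  then show ?case by (simp add: ore_x_mult_0)
next
  case (pCons a p)
  have "ore_x_mult \<sigma> \<delta> (pCons a p) = pCons (\<delta> a) (pCons (\<sigma> a) 0 + ore_x_mult \<sigma> \<delta> p)"
    by (rule poly_eqI)
       (auto simp: coeff_ore_x_mult coeff_pCons automorphism_0 split: nat.splits)
  then show ?case
    by (simp add: ore_mult_pCons_left ore_x_mult_add ore_x_mult_smult ore_mult_add_left
                  pCons.IH add_ac)
qed

lemma ore_mult_assoc:
  "ore_mult \<sigma> \<delta> (ore_mult \<sigma> \<delta> p q) r = ore_mult \<sigma> \<delta> p (ore_mult \<sigma> \<delta> q r)"
proof (induction p arbitrary: q)
  case 0
  then show ?case by simp
next
  case (pCons a p)
  then show ?case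
    by (simp add: ore_mult_pCons_left ore_mult_add_left ore_mult_smult_left ore_x_mult_ore_mult)
qed

end

end

theory Submission
  imports Defs
begin

text \<open>
  A nonzero \<open>p\<close> can be made right divisible by one more linear factor \<open>x - a\<close> by a left multiplication
  with a linear polynomial, so the least common left multiple of \<open>m\<close> linear factors has degree at
  most \<open>m\<close>. If \<open>x - \<alpha>\<^sub>k\<close> divided \<open>\<lambda>\<close> for some \<open>k\<close> that is not an error position, then extending \<open>\<lambda>\<close> by
  the remaining \<open>n - 1 - \<nu>\<close> points would give a nonzero common left multiple of all \<open>x - \<alpha>\<^sub>i\<close> of
  degree less than \<open>n\<close>, against P-independence.
\<close>

lemma mem_left_ideal_iff: "f \<in> left_ideal \<sigma> \<delta> g \<longleftrightarrow> right_dvd \<sigma> \<delta> g f"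
  by (auto simp: left_ideal_def right_dvd_def)

lemma right_dvd_refl: "right_dvd \<sigma> \<delta> f f"
  unfolding right_dvd_def by (metis ore_mult_1_left)

lemma right_dvd_add:
  "right_dvd \<sigma> \<delta> f g \<Longrightarrow> right_dvd \<sigma> \<delta> f h \<Longrightarrow> right_dvd \<sigma> \<delta> f (g + h)"
  unfolding right_dvd_def by (metis ore_mult_add_left)

text \<open>Used in two ways: \<open>p = l\<close> shows that \<open>l\<close> is itself a common
  multiple, and any other common multiple \<open>p\<close> yields minimality.\<close>

lemma right_dvd_lclm_iff:
  assumes "is_lclm \<sigma> \<delta> S l"
  shows "right_dvd \<sigma> \<delta> l p \<longleftrightarrow> (\<forall>f\<in>S. right_dvd \<sigma> \<delta> f p)"
proof -
  have "p \<in> left_ideal \<sigma> \<delta> l \<longleftrightarrow> (\<forall>f\<in>S. p \<in> left_ideal \<sigma> \<delta> f)"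
    using assms by (simp add: is_lclm_def)
  then show ?thesis
    by (simp add: mem_left_ideal_iff)
qed

context
  fixes \<sigma> \<delta> :: "'a::field \<Rightarrow> 'a"
  assumes aut: "field_automorphism \<sigma>" and der: "skew_derivation \<sigma> \<delta>"
begin

lemma automorphism_eq_0_iff: "\<sigma> a = 0 \<longleftrightarrow> a = 0"
  using aut automorphism_0[OF aut der] unfolding field_automorphism_def
  by (metis bij_is_inj inj_eq)

lemma ore_mult_0_right: "ore_mult \<sigma> \<delta> p 0 = 0"
  using ore_mult_add_right[OF aut der, of p 0 0] by (metis add.right_neutral add_left_imp_eq)

text \<open>\<sigma> is injective, so the leading coefficient stays nonzero as it moves up one
  degree; the \<delta> part stays within the old degree.\<close>

lemma degree_ore_x_mult:
  assumes "p \<noteq> 0"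
  shows "degree (ore_x_mult \<sigma> \<delta> p) = Suc (degree p)"
proof (rule antisym)
  show "degree (ore_x_mult \<sigma> \<delta> p) \<le> Suc (degree p)"
    by (rule degree_le)
       (auto simp: coeff_ore_x_mult[OF aut der] coeff_eq_0 automorphism_0[OF aut der] derivation_0[OF aut der])
  show "Suc (degree p) \<le> degree (ore_x_mult \<sigma> \<delta> p)"
    using assms
    by (intro le_degree)
       (simp add: coeff_ore_x_mult[OF aut der] coeff_eq_0 derivation_0[OF aut der] automorphism_eq_0_iff)
qed

text \<open>Peel off the constant term: \<open>(a + p x) q = a q + p (x q)\<close>. For nonzero
  \<open>p\<close> the second summand has strictly larger degree, so nothing cancels its leading
  term, and the product is nonzero because its degree is positive.\<close>

lemma degree_ore_mult:
  assumes "p \<noteq> 0" "q \<noteq> 0"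
  shows "ore_mult \<sigma> \<delta> p q \<noteq> 0 \<and> degree (ore_mult \<sigma> \<delta> p q) = degree p + degree q"
  using assms
proof (induction p arbitrary: q)
  case (pCons a p)
  show ?case
  proof (cases "p = 0")
    case True
    then show ?thesis
      using pCons by (simp add: ore_mult_const_left)
  next
    case False
    have "ore_x_mult \<sigma> \<delta> q \<noteq> 0"
      using degree_ore_x_mult[OF \<open>q \<noteq> 0\<close>] by auto
    then have deg: "degree (ore_mult \<sigma> \<delta> p (ore_x_mult \<sigma> \<delta> q)) = Suc (degree p + degree q)"
      using pCons.IH[OF False] degree_ore_x_mult[OF \<open>q \<noteq> 0\<close>] by simp
    have "degree (smult a q) < degree (ore_mult \<sigma> \<delta> p (ore_x_mult \<sigma> \<delta> q))"
      using deg degree_smult_le[of a q] by simp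
    from degree_add_eq_right[OF this]
    have "degree (ore_mult \<sigma> \<delta> (pCons a p) q) = degree (pCons a p) + degree q"
      using deg False by (simp add: ore_mult_pCons_left[OF aut der])
    then show ?thesis
      using False by auto
  qed
qed simp

lemma right_dvd_ore_mult: "right_dvd \<sigma> \<delta> f g \<Longrightarrow> right_dvd \<sigma> \<delta> f (ore_mult \<sigma> \<delta> u g)"
  unfolding right_dvd_def by (metis ore_mult_assoc[OF aut der])

lemma right_dvd_imp_degree_le:
  assumes "right_dvd \<sigma> \<delta> f g" "g \<noteq> 0"
  shows "degree f \<le> degree g"
proof -
  obtain u where u: "g = ore_mult \<sigma> \<delta> u f"
    using assms unfolding right_dvd_def by blast
  with assms have "u \<noteq> 0" "f \<noteq> 0"
    by (auto simp: ore_mult_0_right)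
  then show ?thesis
    using degree_ore_mult u by simp
qed

lemma ore_x_mult_const_eq:
  "ore_x_mult \<sigma> \<delta> [:r:] = smult (\<sigma> r) (x_minus a) + [:\<sigma> r * a + \<delta> r:]"
  using ore_mult_x_const[OF aut der, of r] by (simp add: ore_mult_x_left)

text \<open>The set of \<open>q\<close> that have a remainder modulo \<open>x - a\<close> is a left ideal containing 1.\<close>

lemma ore_mult_remainder:
  assumes "q = s + [:r:]" "right_dvd \<sigma> \<delta> (x_minus a) s"
  shows "\<exists>s' r'. ore_mult \<sigma> \<delta> p q = s' + [:r':] \<and> right_dvd \<sigma> \<delta> (x_minus a) s'"
  using assms
proof (induction p arbitrary: q s r)
  case 0
  have "right_dvd \<sigma> \<delta> (x_minus a) 0"
    unfolding right_dvd_def by (metis ore_mult_0_left)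
  then show ?case
    by (intro exI[of _ 0]) simp
next
  case (pCons b p)
  \<comment> \<open>One division step: \<open>x s\<close> stays right divisible by
    \<open>x - a\<close>, and \<open>x r\<close> is \<open>\<sigma>(r) (x - a)\<close> plus a
    constant.\<close>
  have "ore_x_mult \<sigma> \<delta> q = (ore_x_mult \<sigma> \<delta> s + smult (\<sigma> r) (x_minus a)) + [:\<sigma> r * a + \<delta> r:]"
    unfolding \<open>q = s + [:r:]\<close>
    by (simp only: ore_x_mult_add[OF aut der] ore_x_mult_const_eq[of r a] add.assoc)
  moreover have "right_dvd \<sigma> \<delta> (x_minus a) (ore_x_mult \<sigma> \<delta> s + smult (\<sigma> r) (x_minus a))"
    using right_dvd_ore_mult[OF pCons.prems(2), of "[:0, 1:]"]
      right_dvd_ore_mult[OF right_dvd_refl[of \<sigma> \<delta> "x_minus a"], of "[:\<sigma> r:]"]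
    by (intro right_dvd_add) (simp_all only: ore_mult_x_left ore_mult_const_left)
  ultimately obtain s' r' where s': "ore_mult \<sigma> \<delta> p (ore_x_mult \<sigma> \<delta> q) = s' + [:r':]"
      "right_dvd \<sigma> \<delta> (x_minus a) s'"
    using pCons.IH by blast
  have "ore_mult \<sigma> \<delta> (pCons b p) q = (smult b s + s') + [:b * r + r':]"
    unfolding ore_mult_pCons_left[OF aut der] s'(1)
    by (simp add: \<open>q = s + [:r:]\<close> smult_add_right)
  moreover have "right_dvd \<sigma> \<delta> (x_minus a) (smult b s + s')"
    using right_dvd_ore_mult[OF pCons.prems(2), of "[:b:]"] s'(2)
    by (intro right_dvd_add) (simp_all only: ore_mult_const_left)
  ultimately show ?case
    by blast
qed

text \<open>Every \<open>p\<close> is a left multiple of 1, and \<open>1 = 0 + 1\<close> already has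
  the required form.\<close>

lemma x_minus_remainder:
  obtains s r where "p = s + [:r:]" "right_dvd \<sigma> \<delta> (x_minus a) s"
proof -
  have "right_dvd \<sigma> \<delta> (x_minus a) 0"
    unfolding right_dvd_def by (metis ore_mult_0_left)
  then show thesis
    using ore_mult_remainder[of 1 0 1 a p] that
    unfolding ore_mult_1_right[OF aut der] by (auto simp: one_pCons)
qed

text \<open>Left multiples of \<open>s\<close> stay divisible in \<open>p = s + r\<close>, so
  \<open>u\<close> only has to carry the constant \<open>r\<close> into the left ideal of
  \<open>x - a\<close>.\<close>

lemma exists_linear_multiple:
  assumes "p \<noteq> 0"
  shows "\<exists>u. u \<noteq> 0 \<and> degree u \<le> 1 \<and> right_dvd \<sigma> \<delta> (x_minus a) (ore_mult \<sigma> \<delta> u p)"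
proof -
  obtain s r where p: "p = s + [:r:]" and s: "right_dvd \<sigma> \<delta> (x_minus a) s"
    by (rule x_minus_remainder)
  show ?thesis
  proof (cases "r = 0")
    case True
    then show ?thesis
      using p s by (intro exI[of _ 1]) (simp add: ore_mult_1_left)
  next
    case False
    \<comment> \<open>The point at which \<open>x - c\<close> absorbs the remainder: \<open>(x - c) r = \<sigma>(r) (x - a)\<close>.\<close>
    define c where "c = (\<sigma> r * a + \<delta> r) / r"
    have "ore_mult \<sigma> \<delta> (x_minus c) [:r:] = ore_mult \<sigma> \<delta> [:\<sigma> r:] (x_minus a)"
      using False
      by (simp add: ore_mult_pCons_left[OF aut der] ore_x_mult_const_eq[of r a] c_def)
    then have "right_dvd \<sigma> \<delta> (x_minus a) (ore_mult \<sigma> \<delta> (x_minus c) [:r:])"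
      unfolding right_dvd_def by blast
    then have "right_dvd \<sigma> \<delta> (x_minus a) (ore_mult \<sigma> \<delta> (x_minus c) p)"
      unfolding p ore_mult_add_right[OF aut der]
      by (intro right_dvd_add[OF right_dvd_ore_mult[OF s]])
    then show ?thesis
      by (intro exI[of _ "x_minus c"]) simp
  qed
qed

text \<open>Each point costs at most one degree, and left multiplication keeps the right divisors
  gained so far. The free starting polynomial serves both \<open>p = 1\<close>, to bound the degree
  of an lclm, and \<open>p = l\<close>, to extend one.\<close>

lemma exists_common_multiple:
  assumes "finite A" "p \<noteq> 0"
  shows "\<exists>q. q \<noteq> 0 \<and> right_dvd \<sigma> \<delta> p q \<and> degree q \<le> degree p + card A \<and>
             (\<forall>a\<in>A. right_dvd \<sigma> \<delta> (x_minus a) q)"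
  using assms(1)
proof (induction A)
  case empty
  show ?case
    using assms(2) by (intro exI[of _ p]) (simp add: right_dvd_refl)
next
  case (insert a A)
  then obtain q where q: "q \<noteq> 0" "right_dvd \<sigma> \<delta> p q" "degree q \<le> degree p + card A"
      "\<forall>b\<in>A. right_dvd \<sigma> \<delta> (x_minus b) q"
    by blast
  obtain u where u: "u \<noteq> 0" "degree u \<le> 1" "right_dvd \<sigma> \<delta> (x_minus a) (ore_mult \<sigma> \<delta> u q)"
    using exists_linear_multiple[OF q(1)] by blast
  show ?case
    using degree_ore_mult[OF u(1) q(1)] u q insert.hyps
    by (intro exI[of _ "ore_mult \<sigma> \<delta> u q"]) (auto intro: right_dvd_ore_mult)
qed

lemma lclm_x_minus_degree_le:
  assumes "finite A" "is_lclm \<sigma> \<delta> (x_minus ` A) l"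
  shows "l \<noteq> 0 \<and> degree l \<le> card A"
proof -
  obtain q where q: "q \<noteq> 0" "degree q \<le> card A" "\<forall>a\<in>A. right_dvd \<sigma> \<delta> (x_minus a) q"
    using exists_common_multiple[OF assms(1), of 1] by auto
  then have "right_dvd \<sigma> \<delta> l q"
    by (simp add: right_dvd_lclm_iff[OF assms(2)])
  then have "degree l \<le> card A"
    using right_dvd_imp_degree_le q by fastforce
  then show ?thesis
    using \<open>right_dvd \<sigma> \<delta> l q\<close> q(1) unfolding right_dvd_def by (auto simp: ore_mult_0_right)
qed

lemma left_P_independent_closed:
  assumes indep: "left_P_independent \<sigma> \<delta> A" and "B \<subseteq> A" "a \<in> A"
    and lclm: "is_lclm \<sigma> \<delta> (x_minus ` B) l" and dvd: "right_dvd \<sigma> \<delta> (x_minus a) l"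
  shows "a \<in> B"
proof (rule ccontr)
  assume "a \<notin> B"
  obtain m where "finite A" and m: "is_lclm \<sigma> \<delta> (x_minus ` A) m" "degree m = card A"
    using indep unfolding left_P_independent_def by blast
  then have fin: "finite B"
    using \<open>B \<subseteq> A\<close> finite_subset by blast
  have l: "l \<noteq> 0" "degree l \<le> card B"
    using lclm_x_minus_degree_le[OF fin lclm] by auto
  \<comment> \<open>The inequality guards the truncated subtraction in the equation; it holds since
    \<open>insert a B\<close> lies in \<open>A\<close> and has one element more than
    \<open>B\<close>.\<close>
  have card: "card (A - insert a B) = card A - Suc (card B)" "Suc (card B) \<le> card A"
    using \<open>finite A\<close> fin \<open>B \<subseteq> A\<close> \<open>a \<in> A\<close> \<open>a \<notin> B\<close> card_mono[of A "insert a B"]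
    by (auto simp: card_Diff_subset)
  \<comment> \<open>No factor is spent on \<open>a\<close>, because \<open>l\<close> already brings
    it; this saves the one degree that gives the contradiction.\<close>
  obtain q where q: "q \<noteq> 0" "right_dvd \<sigma> \<delta> l q" "degree q \<le> degree l + card (A - insert a B)"
      "\<forall>b\<in>A - insert a B. right_dvd \<sigma> \<delta> (x_minus b) q"
    using exists_common_multiple[of "A - insert a B" l] \<open>finite A\<close> l by auto
  have "right_dvd \<sigma> \<delta> (x_minus a) q"
    using q(2) dvd right_dvd_ore_mult unfolding right_dvd_def[of _ _ l] by blast
  moreover have "\<forall>b\<in>B. right_dvd \<sigma> \<delta> (x_minus b) q"
    using q(2) by (simp add: right_dvd_lclm_iff[OF lclm])
  ultimately have "\<forall>b\<in>A. right_dvd \<sigma> \<delta> (x_minus b) q"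
    using q(4) by blast
  then have "right_dvd \<sigma> \<delta> m q"
    by (simp add: right_dvd_lclm_iff[OF m(1)])
  then have "card A \<le> degree q"
    using right_dvd_imp_degree_le q(1) m(2) by metis
  then show False
    using q(3) l(2) card by linarith
qed

end

theorem proposition9:
  fixes \<sigma> \<delta> :: "'a::field \<Rightarrow> 'a"
    and F :: "'a set" and C :: "(nat \<Rightarrow> 'a) set"
    and g lam :: "'a poly"
    and \<alpha> \<eta> e err :: "nat \<Rightarrow> 'a"
    and n \<nu> k :: nat and pos :: "nat \<Rightarrow> nat"
  assumes "field_automorphism \<sigma>" and "finite_order \<sigma>" and "skew_derivation \<sigma> \<delta>"
    and "skew_differential_goppa_code \<sigma> \<delta> F n g \<alpha> \<eta> C"
    and "left_P_independent \<sigma> \<delta> (\<alpha> ` {..<n})"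
    and "\<forall>j\<in>{1..\<nu>}. pos j < n" and "inj_on pos {1..\<nu>}"
    and "\<forall>j\<in>{1..\<nu>}. err j \<noteq> 0"
    and "e = (\<lambda>i. \<Sum>j=1..\<nu>. err j * canonical_vec (pos j) i)"
    and "e \<in> vecs F n"
    and "\<nu> \<le> degree g div 2"
    and "is_lclm \<sigma> \<delta> {x_minus (\<alpha> (pos j)) |j. j \<in> {1..\<nu>}} lam"
    and "k < n"
  shows "right_dvd \<sigma> \<delta> (x_minus (\<alpha> k)) lam \<longleftrightarrow> k \<in> pos ` {1..\<nu>}"
proof -
  have set_eq: "{x_minus (\<alpha> (pos j)) |j. j \<in> {1..\<nu>}} = x_minus ` \<alpha> ` pos ` {1..\<nu>}"
    by blast
  have lclm: "is_lclm \<sigma> \<delta> (x_minus ` \<alpha> ` pos ` {1..\<nu>}) lam"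
    using assms(12) unfolding set_eq .
  have sub: "pos ` {1..\<nu>} \<subseteq> {..<n}"
    using assms(6) by auto
  have inj: "inj_on \<alpha> {..<n}"
    using assms(4) unfolding skew_differential_goppa_code_def by blast
  show ?thesis
  proof
    assume "right_dvd \<sigma> \<delta> (x_minus (\<alpha> k)) lam"
    then have "\<alpha> k \<in> \<alpha> ` pos ` {1..\<nu>}"
      using left_P_independent_closed[OF assms(1,3,5) _ _ lclm] sub \<open>k < n\<close> by blast
    \<comment> \<open>The closedness argument speaks of points; injectivity of \<alpha> turns the
      point back into its index.\<close>
    then show "k \<in> pos ` {1..\<nu>}"
      using inj_on_image_mem_iff[OF inj _ sub] \<open>k < n\<close> by simp
  next
    assume "k \<in> pos ` {1..\<nu>}"
    \<comment> \<open>\<open>lam\<close> right divides itself, hence so does each of the linear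
      factors defining it.\<close>
    then show "right_dvd \<sigma> \<delta> (x_minus (\<alpha> k)) lam"
      using right_dvd_lclm_iff[OF lclm, of lam] right_dvd_refl[of \<sigma> \<delta> lam] by blast
  qed
qed

end
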